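(* Let $i \in \{1,2,3,4\}$, let $u$ be a user, and let $\mathcal{I}^{i-1}$ be the finite candidate set of stage $i$, from which exactly $c_i$ items must be selected. Let $$\mathcal{I}^{i,PRP} \in \arg\max_{\mathcal{I}^i \subset \mathcal{I}^{i-1},\ |\mathcal{I}^i| = c_i}\ \sum_{v \in \mathcal{I}^i} r(u,v).$$ Then $\mathcal{I}^{i,PRP}$ is also a solution of the max-min problem $$\arg\max_{\mathcal{I}^i \subset \mathcal{I}^{i-1},\ |\mathcal{I}^i| = c_i}\ \ \min_{\{v_1,\dots,v_{c_4}\} \subset \mathcal{I}^i}\ \sum_{k=1}^{c_4} r(u,v_k),$$ where the inner minimum is over all sets of $c_4$ distinct items of $\mathcal{I}^i$.
   Context: A four-stage retrieval system processes a request of a user $u$ as follows. Start from a finite set $\mathcal{I}^0 = \mathcal{I}$ of all items. At stage $i \in \{1,2,3,4\}$ the input is a candidate set $\mathcal{I}^{i-1}$ and the output is a subset $\mathcal{I}^i \subset \mathcal{I}^{i-1}$ with $|\mathcal{I}^i| = c_i$, where $c_1, c_2, c_3, c_4$ are predefined positive integers with $|\mathcal{I}| \ge c_1 \ge c_2 \ge c_3 \ge c_4 \geq 1$. The items in $\mathcal{I}^4$ are shown to the user. The function $r(u,v) \in [0,1]$ is the underlying interest of user $u$ in item $v$. An argmax may have several maximizers; $\mathcal{I}^{i,PRP}$ denotes any maximizer of the first problem. *)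

theory Defs
  imports Complex_Main
begin

end

theory Submission
  imports Defs
begin

text \<open>
  By an exchange argument, no item outside a sum-maximal selection \<open>P\<close> beats an item inside it.
  Hence for every other selection \<open>S\<close> of the same size there is a bijection from \<open>P\<close> to \<open>S\<close>, fixing
  \<open>P \<inter> S\<close>, that never increases the value. It maps each \<open>m\<close>-subset of \<open>P\<close> to an \<open>m\<close>-subset of
  \<open>S\<close> of at most the same sum, so the minimum over \<open>S\<close> cannot exceed the one over \<open>P\<close>.
\<close>

text \<open>Replacing \<open>v\<close> by \<open>w\<close> in \<open>P\<close> keeps the selection
  feasible and changes its sum by \<open>f w - f v\<close>, which maximality of \<open>P\<close>
  forces to be at most zero.\<close>

lemma arg_max_sum_exchange:
  fixes f :: "'a \<Rightarrow> 'b::linordered_ab_group_add"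
  assumes P: "is_arg_max (sum f) (\<lambda>S. S \<subseteq> C \<and> card S = n) P"
    and "finite P" "v \<in> P" "w \<in> C - P"
  shows "f w \<le> f v"
proof -
  let ?Q = "insert w (P - {v})"
  have "card ?Q = card P"
    using assms card_Suc_Diff1[of P v] by simp
  then have "?Q \<subseteq> C" "card ?Q = n"
    using assms by (auto simp: is_arg_max_def)
  then have "sum f ?Q \<le> sum f P"
    using P by (simp add: is_arg_max_linorder)
  moreover have "sum f ?Q = f w + sum f (P - {v})"
    using assms by simp
  moreover have "sum f P = f v + sum f (P - {v})"
    using assms by (simp add: sum.remove)
  ultimately show ?thesis
    by simp
qed

lemma arg_max_sum_bij_betw:
  fixes f :: "'a \<Rightarrow> 'b::linordered_ab_group_add"
  assumes P: "is_arg_max (sum f) (\<lambda>S. S \<subseteq> C \<and> card S = n) P"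
    and S: "S \<subseteq> C" "card S = n" and n: "0 < n"
  obtains g where "bij_betw g P S" "\<And>v. v \<in> P \<Longrightarrow> f (g v) \<le> f v"
proof -
  have card: "card P = n"
    using P by (simp add: is_arg_max_def)
  \<comment> \<open>Infinite sets have \<open>card\<close> 0, so the positive cardinality
    \<open>n\<close> forces finiteness.\<close>
  then have fin: "finite P" "finite S"
    using S n by (auto intro: card_ge_0_finite)
  then have "card (P - S) = card (S - P)"
    using card S by (simp add: card_Diff_subset_Int Int_commute)
  \<comment> \<open>Any bijection serves here: the exchange argument compares every element of
    \<open>P\<close> with every element of \<open>C - P\<close>, so no matching by value is
    required.\<close>
  then obtain h where h: "bij_betw h (P - S) (S - P)"
    using fin finite_same_card_bij by blast
  define g where "g v = (if v \<in> P - S then h v else v)" for v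
  have "bij_betw g (P - S) (S - P)"
    using h by (rule bij_betw_cong[THEN iffD1, rotated]) (simp add: g_def)
  moreover have "bij_betw g (P \<inter> S) (P \<inter> S)"
    by (rule bij_betw_cong[THEN iffD1, OF _ bij_betw_id]) (simp add: g_def)
  ultimately have "bij_betw g ((P - S) \<union> (P \<inter> S)) ((S - P) \<union> (P \<inter> S))"
    by (rule bij_betw_combine) blast
  moreover have "(P - S) \<union> (P \<inter> S) = P" "(S - P) \<union> (P \<inter> S) = S"
    by blast+
  ultimately have "bij_betw g P S"
    by simp
  moreover have "f (g v) \<le> f v" if "v \<in> P" for v
  proof (cases "v \<in> S")
    case False
    then have "h v \<in> C - P"
      using h that S by (auto dest: bij_betwE)
    then show ?thesis
      using False that arg_max_sum_exchange[OF P fin(1)] by (simp add: g_def)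
  qed (simp add: g_def)
  ultimately show ?thesis
    by (rule that)
qed

lemma is_arg_max_Min_sum_subsets:
  fixes f :: "'a \<Rightarrow> 'b::linordered_ab_group_add"
  assumes P: "is_arg_max (sum f) (\<lambda>S. S \<subseteq> C \<and> card S = n) P"
    and "m \<le> n" "0 < n"
  shows "is_arg_max (\<lambda>S. Min {sum f T |T. T \<subseteq> S \<and> card T = m})
           (\<lambda>S. S \<subseteq> C \<and> card S = n) P"
proof -
  define A where "A S = {sum f T |T. T \<subseteq> S \<and> card T = m}" for S
  have feasible: "P \<subseteq> C" "card P = n"
    using P by (simp_all add: is_arg_max_def)
  have fin: "finite (A S)" if "card S = n" for S
  proof -
    have "finite (Pow S)"
      using that \<open>0 < n\<close> by (auto intro: card_ge_0_finite)
    then show ?thesis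
      by (rule finite_surj[where f = "sum f"]) (auto simp: A_def)
  qed
  \<comment> \<open>Since \<open>m \<le> n\<close>, some \<open>m\<close>-subset of \<open>P\<close>
    exists, so \<open>Min (A P)\<close> is a genuine minimum, attained at some
    \<open>T\<close>.\<close>
  have "A P \<noteq> {}"
    using obtain_subset_with_card_n[of m P] feasible \<open>m \<le> n\<close> by (auto simp: A_def)
  then have "Min (A P) \<in> A P"
    using fin feasible by simp
  then obtain T where T: "T \<subseteq> P" "card T = m" "Min (A P) = sum f T"
    by (auto simp: A_def)
  have "Min (A S) \<le> Min (A P)" if S: "S \<subseteq> C" "card S = n" for S
  proof -
    obtain g where g: "bij_betw g P S" "\<And>v. v \<in> P \<Longrightarrow> f (g v) \<le> f v"
      using arg_max_sum_bij_betw[OF P S \<open>0 < n\<close>] by blast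
    \<comment> \<open>Injectivity is used twice: the image of the minimizer \<open>T\<close> is
      again an \<open>m\<close>-set, hence a competitor inside \<open>S\<close>, and its sum can be
      reindexed over \<open>T\<close>.\<close>
    have inj: "inj_on g T"
      using g T bij_betw_imp_inj_on inj_on_subset by blast
    have "g ` T \<subseteq> S" "card (g ` T) = m"
      using g T inj by (auto simp: card_image dest: bij_betwE)
    then have "sum f (g ` T) \<in> A S"
      by (auto simp: A_def)
    then have "Min (A S) \<le> sum f (g ` T)"
      using fin S by simp
    also have "\<dots> = (\<Sum>v\<in>T. f (g v))"
      using inj by (simp add: sum.reindex)
    also have "\<dots> \<le> sum f T"
      using g T by (intro sum_mono) auto
    finally show ?thesis
      using T by simp
  qed
  then show ?thesis
    using feasible by (simp add: is_arg_max_linorder A_def)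
qed

theorem proposition1:
  fixes r :: "'user \<Rightarrow> 'item \<Rightarrow> real"
    and items :: "'item set"
    and c :: "nat \<Rightarrow> nat"
    and cand :: "nat \<Rightarrow> 'item set"
    and i :: nat and u :: 'user and PRP :: "'item set"
  assumes "finite items"
    and "\<And>u v. v \<in> items \<Longrightarrow> 0 \<le> r u v \<and> r u v \<le> 1"
    and "card items \<ge> c 1" and "c 1 \<ge> c 2" and "c 2 \<ge> c 3" and "c 3 \<ge> c 4" and "c 4 \<ge> 1"
    and "i \<in> {1, 2, 3, 4}"
    and "cand 0 = items"
    and "\<And>j. 1 \<le> j \<Longrightarrow> j < i \<Longrightarrow> cand j \<subseteq> cand (j - 1) \<and> card (cand j) = c j"
    and "is_arg_max (\<lambda>S. \<Sum>v\<in>S. r u v)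
           (\<lambda>S. S \<subseteq> cand (i - 1) \<and> card S = c i) PRP"
  shows "is_arg_max (\<lambda>S. Min {\<Sum>v\<in>T. r u v |T. T \<subseteq> S \<and> card T = c 4})
           (\<lambda>S. S \<subseteq> cand (i - 1) \<and> card S = c i) PRP"
proof (rule is_arg_max_Min_sum_subsets)
  \<comment> \<open>The decreasing chain of sizes gives the first bound for each of the four stages;
    \<open>c 4 \<ge> 1\<close> then gives positivity.\<close>
  show "c 4 \<le> c i" "0 < c i"
    using assms(4-8) by auto
qed (fact assms(11))

end
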